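(* Let $|\psi\rangle_{AB}$ (the donor) and $|\phi\rangle_{ab}$ (the acceptor) be pure two-qubit states, where $A,B,a,b$ are qubits, one party holds $A$ and $a$, and the other party holds $B$ and $b$. Let $\Delta E>0$ satisfy $\Delta E\le E(\psi)$ and $E(\phi)+\Delta E\le 1$. Then the following are equivalent: (i) there exist pure two-qubit states $|\psi'\rangle_{AB}$ and $|\phi'\rangle_{ab}$ with $E(\psi')=E(\psi)-\Delta E$ and $E(\phi')=E(\phi)+\Delta E$ such that $|\psi\rangle_{AB}\otimes|\phi\rangle_{ab}$ can be transformed with certainty into $|\psi'\rangle_{AB}\otimes|\phi'\rangle_{ab}$ by LOCC with respect to the bipartition $Aa:Bb$; (ii) $\Delta E=E(\psi)-E(\phi)$.
   Context: For a bipartite pure state with Schmidt coefficients $\{\lambda_i\}$ (nonnegative numbers with sum $1$: the eigenvalues of the reduced density matrix, i.e. the squares of the amplitudes in the Schmidt decomposition), $E=-\sum_i\lambda_i\log_2\lambda_i$ denotes the entropy of entanglement. For a two-qubit state $\cos\beta\,|\mu\rangle|\nu\rangle+\sin\beta\,|\mu^\perp\rangle|\nu^\perp\rangle$ this is $H[\cos^2\beta]$ with $H[x]=-x\log_2x-(1-x)\log_2(1-x)$. LOCC means local operations and classical communication. By Nielsen's majorization theorem (known), a bipartite pure state with decreasingly ordered Schmidt coefficients $\lambda_1\ge\dots\ge\lambda_d$ can be transformed with certainty by LOCC into one with decreasingly ordered Schmidt coefficients $\lambda_1'\ge\dots\ge\lambda_d'$ (padded by zeros to the same length) if and only if $\sum_{i\le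 k}\lambda_i'\ge\sum_{i\le k}\lambda_i$ for all $k=1,\dots,d$. This may be taken as the definition of LOCC-transformability of pure states. The Schmidt coefficients of a state $|\psi\rangle_{AB}\otimes|\phi\rangle_{ab}$ across the bipartition $Aa:Bb$ are the products of the Schmidt coefficients of $|\psi\rangle$ (across $A:B$) and those of $|\phi\rangle$ (across $a:b$). *)

theory Defs
  imports "HOL-Analysis.Analysis" "HOL-Computational_Algebra.Computational_Algebra"
begin

text \<open>
  A state vector of a bipartite system is given by its amplitudes in the product basis; the first
  component of the index belongs to the first party, the second one to the second party.
\<close>

type_synonym ('a, 'b) bipartite = "(complex, 'a \<times> 'b) vec"

type_synonym two_qubit = "(2, 2) bipartite"

definition pure_state :: "('a::finite, 'b::finite) bipartite \<Rightarrow> bool" where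
  "pure_state \<psi> \<longleftrightarrow> norm \<psi> = 1"

text \<open>
  The tensor product of a state on \<open>A:B\<close> and a state on \<open>a:b\<close>, with the factors regrouped so that
  the result is a state on the bipartition \<open>Aa:Bb\<close>.
\<close>

definition tensor_state ::
    "('a::finite, 'b::finite) bipartite \<Rightarrow> ('c::finite, 'd::finite) bipartite
      \<Rightarrow> ('a \<times> 'c, 'b \<times> 'd) bipartite"  (infixr "\<otimes>\<^sub>s" 70) where
  "\<psi> \<otimes>\<^sub>s \<phi> = vec_lambda (\<lambda>((i, k), (j, l)). \<psi> $ (i, j) * \<phi> $ (k, l))"

text \<open>The partial trace of the projector onto \<open>\<psi>\<close> over the second party.\<close>

definition reduced_density :: "('a::finite, 'b::finite) bipartite \<Rightarrow> complex ^ 'a ^ 'a" where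
  "reduced_density \<psi> = (\<chi> i j. \<Sum>k\<in>UNIV. \<psi> $ (i, k) * cnj (\<psi> $ (j, k)))"

definition charpoly :: "complex ^ 'n ^ 'n \<Rightarrow> complex poly" where
  "charpoly A = det (mat [:0, 1:] - (\<chi> i j. [:A $ i $ j:]))"

text \<open>
  Eigenvalues are counted with multiplicity. Those of a reduced density matrix are real, as it is
  Hermitian, so that taking real parts only changes the type.
\<close>

definition schmidt_coeffs :: "('a::finite, 'b::finite) bipartite \<Rightarrow> real multiset" where
  "schmidt_coeffs \<psi> = image_mset Re (proots (charpoly (reduced_density \<psi>)))"

definition schmidt_list :: "('a::finite, 'b::finite) bipartite \<Rightarrow> real list" where
  "schmidt_list \<psi> = rev (sorted_list_of_multiset (schmidt_coeffs \<psi>))"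

text \<open>The convention \<open>0 * log 2 0 = 0\<close> holds since multiplication by \<open>0\<close> gives \<open>0\<close>.\<close>

definition entanglement :: "('a::finite, 'b::finite) bipartite \<Rightarrow> real" where
  "entanglement \<psi> = - (\<Sum>x\<in>#schmidt_coeffs \<psi>. x * log 2 x)"

text \<open>
  Deterministic LOCC transformability of pure states, defined through Nielsen's majorization
  criterion. Both lists have length \<open>CARD('a)\<close>, so no padding by zeros is needed.
\<close>

definition LOCC_transformable ::
    "('a::finite, 'b::finite) bipartite \<Rightarrow> ('a, 'b) bipartite \<Rightarrow> bool" where
  "LOCC_transformable \<psi> \<psi>' \<longleftrightarrow>
     (\<forall>k\<in>{1..CARD('a)}. sum_list (take k (schmidt_list \<psi>')) \<ge> sum_list (take k (schmidt_list \<psi>)))"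

end

theory Submission
  imports Defs
begin

text \<open>
  The entropy of entanglement is additive under tensor products, so the transformation in (i)
  preserves the entropy of the joint state. Since the entropy is strictly Schur concave, Nielsen's
  criterion then forces the two joint Schmidt spectra to coincide. The largest and the smallest
  element of the spectrum determine the product and the sum of the two larger Schmidt coefficients,
  so they are merely permuted; as the entanglement of the donor changes, they are exchanged.
  Conversely, if \<open>\<Delta>E = E(\<psi>) - E(\<phi>)\<close>, one may take \<open>\<psi>' = \<phi>\<close> and \<open>\<phi>' = \<psi>\<close>.
\<close>

unbundle no Formal_Power_Series.fps_syntax

section \<open>Equality case of Schur concavity of the entropy\<close>

text \<open>Summation by parts: the right-hand side exceeds the boundary term by the sum of the
  assumed nonnegative products. The sign condition is put on products because \<open>c\<close> will
  be \<open>ln\<close> of a decreasing sequence that may reach 0; there \<open>ln\<close> loses its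
  monotonicity, but the partial sum vanishes.\<close>

lemma abel_sum_ge:
  fixes c d :: "nat \<Rightarrow> real"
  assumes "\<And>k. k < n \<Longrightarrow> 0 \<le> (c k - c (Suc k)) * (\<Sum>i\<le>k. d i)"
  shows "c n * (\<Sum>i\<le>n. d i) \<le> (\<Sum>i\<le>n. c i * d i)"
  using assms
proof (induction n)
  case (Suc n)
  have "c n * (\<Sum>i\<le>n. d i) \<le> (\<Sum>i\<le>n. c i * d i)"
    using Suc by simp
  with Suc.prems[of n] show ?case
    by (simp add: algebra_simps)
qed simp

text \<open>This is \<open>ln t \<le> t - 1\<close> at \<open>t = x / y\<close>, multiplied by
  \<open>y\<close>, with equality only at \<open>t = 1\<close>. The left-hand factor form
  \<open>y * (ln y - ln x)\<close> is one summand of the relative entropy of \<open>y\<close> with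
  respect to \<open>x\<close>.\<close>

lemma relative_entropy_term_ge:
  fixes x y :: real
  assumes "0 \<le> x" "0 \<le> y" "x = 0 \<Longrightarrow> y = 0"
  shows "y - x \<le> y * (ln y - ln x)"
    and "y * (ln y - ln x) = y - x \<Longrightarrow> y = x"
proof -
  have *: "y - x \<le> y * (ln y - ln x) \<and> (y * (ln y - ln x) = y - x \<longrightarrow> y = x)"
  proof (cases "x = 0 \<or> y = 0")
    case False
    then have pos: "x > 0" "y > 0" using assms by auto
    have "ln (x / y) \<le> x / y - 1"
      using pos by (intro ln_le_minus_one) simp
    then have 1: "y * ln (x / y) \<le> x - y"
      using pos by (simp add: field_simps)
    have 2: "y * (ln y - ln x) = - (y * ln (x / y))"
      using pos by (simp add: ln_div algebra_simps)
    have "y = x" if "y * (ln y - ln x) = y - x"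
    proof -
      have "ln (x / y) = x / y - 1"
        using that 2 pos by (simp add: field_simps)
      then have "x / y = 1"
        using pos by (intro ln_eq_minus_one) auto
      then show ?thesis using pos by simp
    qed
    with 1 2 show ?thesis by linarith
  qed (use assms in auto)
  show "y - x \<le> y * (ln y - ln x)" "y * (ln y - ln x) = y - x \<Longrightarrow> y = x"
    using * by auto
qed

text \<open>For equal entropies the relative entropy of \<open>y\<close> with respect to
  \<open>x\<close> equals minus the sum of \<open>ln (x i) * (y i - x i)\<close>, which is at most 0
  by Abel summation and majorization. Its terms are bounded below by \<open>y i - x i\<close>, whose
  sum is 0, so every bound is attained and its equality case applies.\<close>

lemma majorization_entropy_eq_imp_eq:
  fixes x y :: "nat \<Rightarrow> real"
  assumes nonneg: "\<And>i. i \<le> n \<Longrightarrow> 0 \<le> x i" "\<And>i. i \<le> n \<Longrightarrow> 0 \<le> y i"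
    and decr: "\<And>i j. i \<le> j \<Longrightarrow> j \<le> n \<Longrightarrow> x j \<le> x i"
    and major: "\<And>k. k \<le> n \<Longrightarrow> (\<Sum>i\<le>k. x i) \<le> (\<Sum>i\<le>k. y i)"
    and total: "(\<Sum>i\<le>n. x i) = (\<Sum>i\<le>n. y i)"
    and entropy: "(\<Sum>i\<le>n. x i * ln (x i)) = (\<Sum>i\<le>n. y i * ln (y i))"
    and "k \<le> n"
  shows "x k = y k"
proof -
  \<comment> \<open>Where \<open>x\<close> vanishes, so does \<open>y\<close>, which makes the junk value \<open>ln 0\<close> harmless.\<close>
  have tail: "y (Suc k) = 0 \<and> (\<Sum>i\<le>k. y i - x i) = 0" if k: "k < n" "x (Suc k) = 0" for k
  proof -
    have "(\<Sum>i\<le>n. x i) = (\<Sum>i\<le>k. x i)"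
    proof (rule sum.mono_neutral_right)
      show "\<forall>i\<in>{..n} - {..k}. x i = 0"
      proof
        fix i assume "i \<in> {..n} - {..k}"
        then show "x i = 0"
          using decr[of "Suc k" i] nonneg(1)[of i] k by auto
      qed
    qed (use k in auto)
    \<comment> \<open>Squeeze: the first entries of \<open>x\<close> already carry the whole total,
      and those of \<open>y\<close> carry at least as much, so nothing is left for
      \<open>y (Suc k)\<close>.\<close>
    moreover have "(\<Sum>i\<le>Suc k. y i) \<le> (\<Sum>i\<le>n. y i)"
      using k nonneg(2) by (intro sum_mono2) auto
    moreover have "0 \<le> y (Suc k)" "(\<Sum>i\<le>k. x i) \<le> (\<Sum>i\<le>k. y i)"
      using k nonneg(2) major by auto
    ultimately show ?thesis
      using total by (simp add: sum_subtractf)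
  qed
  have supp: "y i = 0" if "i \<le> n" "x i = 0" for i
  proof (cases i)
    \<comment> \<open>Here the largest entry of \<open>x\<close> is 0, so both sequences vanish
      entirely.\<close>
    case 0
    then have "(\<Sum>j\<le>n. x j) = 0"
      using that decr nonneg(1) by (intro sum.neutral) (metis atMost_iff antisym le0)
    then have "(\<Sum>j\<le>n. y j) = 0"
      using total by simp
    then have "\<forall>j\<in>{..n}. y j = 0"
      using nonneg(2) by (subst (asm) sum_nonneg_eq_0_iff) auto
    then show ?thesis using that by simp
  qed (use that tail in auto)
  \<comment> \<open>The boundary term on the left is 0, since the totals agree.\<close>
  have "ln (x n) * (\<Sum>i\<le>n. y i - x i) \<le> (\<Sum>i\<le>n. ln (x i) * (y i - x i))"
  proof (rule abel_sum_ge)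
    fix k assume k: "k < n"
    show "0 \<le> (ln (x k) - ln (x (Suc k))) * (\<Sum>i\<le>k. y i - x i)"
    proof (cases "x (Suc k) = 0")
      case False
      then have "0 < x (Suc k)" "x (Suc k) \<le> x k"
        using nonneg(1)[of "Suc k"] decr[of k "Suc k"] k by auto
      then have "ln (x (Suc k)) \<le> ln (x k)"
        by simp
      with major[of k] k show ?thesis
        by (intro mult_nonneg_nonneg) (auto simp: sum_subtractf)
    qed (use tail k in simp)
  qed
  then have "0 \<le> (\<Sum>i\<le>n. ln (x i) * (y i - x i))"
    using total by (simp add: sum_subtractf)
  moreover have "(\<Sum>i\<le>n. y i * (ln (y i) - ln (x i)) - (y i - x i))
      = - (\<Sum>i\<le>n. ln (x i) * (y i - x i))"
    using total entropy by (simp add: algebra_simps sum_subtractf sum.distrib)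
  moreover have gap: "0 \<le> y i * (ln (y i) - ln (x i)) - (y i - x i)" if "i \<in> {..n}" for i
    using relative_entropy_term_ge(1)[of "x i" "y i"] nonneg supp that by auto
  then have "0 \<le> (\<Sum>i\<le>n. y i * (ln (y i) - ln (x i)) - (y i - x i))"
    by (rule sum_nonneg)
  ultimately have "(\<Sum>i\<le>n. y i * (ln (y i) - ln (x i)) - (y i - x i)) = 0"
    by linarith
  then have "y k * (ln (y k) - ln (x k)) - (y k - x k) = 0"
    using gap \<open>k \<le> n\<close> by (subst (asm) sum_nonneg_eq_0_iff) auto
  then show ?thesis
    using relative_entropy_term_ge(2)[of "x k" "y k"] nonneg supp \<open>k \<le> n\<close> by auto
qed

text \<open>The decreasingly sorted spectra satisfy the hypotheses of the indexed lemma, so they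
  agree entry by entry, and hence as multisets.\<close>

lemma LOCC_transformable_entanglement_eq_imp_schmidt_coeffs_eq:
  fixes \<psi> \<psi>' :: "('a::finite, 'b::finite) bipartite"
  assumes locc: "LOCC_transformable \<psi> \<psi>'"
    and size: "size (schmidt_coeffs \<psi>) = CARD('a)" "size (schmidt_coeffs \<psi>') = CARD('a)"
    and nonneg: "\<And>x. x \<in># schmidt_coeffs \<psi> \<Longrightarrow> 0 \<le> x"
      "\<And>x. x \<in># schmidt_coeffs \<psi>' \<Longrightarrow> 0 \<le> x"
    and total: "sum_mset (schmidt_coeffs \<psi>) = sum_mset (schmidt_coeffs \<psi>')"
    and entropy: "entanglement \<psi> = entanglement \<psi>'"
  shows "schmidt_coeffs \<psi> = schmidt_coeffs \<psi>'"
proof -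
  define n where "n = CARD('a) - 1"
  have n: "CARD('a) = Suc n"
    unfolding n_def by simp
  define xs where "xs = schmidt_list \<psi>"
  define ys where "ys = schmidt_list \<psi>'"
  have mset: "mset xs = schmidt_coeffs \<psi>" "mset ys = schmidt_coeffs \<psi>'"
    by (simp_all add: xs_def ys_def schmidt_list_def)
  have len: "length xs = Suc n" "length ys = Suc n"
    using size n mset by (metis size_mset)+
  have nth_sum: "(\<Sum>x\<in>#mset zs. f x) = (\<Sum>i\<le>n. f (zs ! i))"
    if "length zs = Suc n" for zs and f :: "real \<Rightarrow> real"
  proof -
    have "(\<Sum>x\<in>#mset zs. f x) = sum_list (map f zs)"
      by (metis mset_map sum_mset_sum_list)
    then show ?thesis
      using that by (simp add: sum_list_sum_nth atLeast0LessThan lessThan_Suc_atMost)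
  qed
  have take_sum: "sum_list (take (Suc k) zs) = (\<Sum>i\<le>k. zs ! i)"
    if "length zs = Suc n" "k \<le> n" for zs :: "real list" and k
    using that by (simp add: sum_list_sum_nth atLeast0LessThan lessThan_Suc_atMost min_def)
  have "xs ! k = ys ! k" if "k \<le> n" for k
  proof (rule majorization_entropy_eq_imp_eq[of n "nth xs" "nth ys"])
    show "0 \<le> xs ! i" "0 \<le> ys ! i" if "i \<le> n" for i
      using that nonneg len mset by (metis le_imp_less_Suc nth_mem set_mset_mset)+
    show "xs ! j \<le> xs ! i" if "i \<le> j" "j \<le> n" for i j
    proof -
      have "sorted (rev xs)"
        by (simp add: xs_def schmidt_list_def)
      then show ?thesis
        using that len by (simp add: sorted_rev_nth_mono)
    qed
    show "(\<Sum>i\<le>k. xs ! i) \<le> (\<Sum>i\<le>k. ys ! i)" if "k \<le> n" for k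
    proof -
      \<comment> \<open>The sum over indices up to \<open>k\<close> is the prefix sum of length
        \<open>Suc k\<close>.\<close>
      have "Suc k \<in> {1..CARD('a)}"
        using that n by simp
      then have "sum_list (take (Suc k) xs) \<le> sum_list (take (Suc k) ys)"
        using locc unfolding LOCC_transformable_def xs_def ys_def by blast
      then show ?thesis
        using that len by (simp add: take_sum)
    qed
    show "(\<Sum>i\<le>n. xs ! i) = (\<Sum>i\<le>n. ys ! i)"
      using total nth_sum[of xs "\<lambda>x. x"] nth_sum[of ys "\<lambda>x. x"] len mset by simp
    have "(\<Sum>i\<le>n. xs ! i * log 2 (xs ! i)) = (\<Sum>i\<le>n. ys ! i * log 2 (ys ! i))"
      using entropy nth_sum[of xs "\<lambda>x. x * log 2 x"] nth_sum[of ys "\<lambda>x. x * log 2 x"] len mset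
      by (simp add: entanglement_def)
    \<comment> \<open>Changing the base only removes the common divisor \<open>ln 2\<close>.\<close>
    then show "(\<Sum>i\<le>n. xs ! i * ln (xs ! i)) = (\<Sum>i\<le>n. ys ! i * ln (ys ! i))"
      by (simp add: log_def flip: sum_divide_distrib)
  qed fact
  then have "xs = ys"
    using len by (intro nth_equalityI) auto
  then show ?thesis
    using mset by simp
qed

section \<open>Schmidt coefficients of tensor products\<close>

text \<open>The columns of \<open>P\<close> are eigenvectors; for square matrices a right inverse
  \<open>Q\<close> already makes \<open>P\<close> invertible.\<close>

definition diagonalized_by :: "complex ^ 'n ^ 'n \<Rightarrow> ('n \<Rightarrow> complex) \<Rightarrow> bool" where
  "diagonalized_by A d \<longleftrightarrow>
     (\<exists>P Q. P ** Q = mat 1 \<and> A ** P = P ** (\<chi> i j. if i = j then d i else 0))"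

lemma proots_prod_linear:
  "finite A \<Longrightarrow> proots (\<Prod>i\<in>A. [:- d i, 1:]) = image_mset d (mset_set A)"
  for d :: "'i \<Rightarrow> complex"
  by (induction A rule: finite_induct) (simp_all add: proots_mult del: mult_pCons_left)

text \<open>Similarity invariance: with X the indeterminate and D the diagonal matrix, (X - A) P = P
  (X - D) over the polynomial ring; take determinants and cancel that of P.\<close>

lemma charpoly_diagonalized:
  assumes "diagonalized_by A d"
  shows "charpoly A = (\<Prod>i\<in>UNIV. [:- d i, 1:])"
proof -
  obtain P Q where PQ: "P ** Q = mat 1"
    and AP: "A ** P = P ** (\<chi> i j. if i = j then d i else 0)"
    using assms by (auto simp: diagonalized_by_def)
  \<comment> \<open>Constants embed into polynomials as a ring homomorphism, so matrix identities
    carry over.\<close>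
  define lift :: "complex ^ 'a ^ 'a \<Rightarrow> complex poly ^ 'a ^ 'a"
    where "lift M = (\<chi> i j. [:M $ i $ j:])" for M
  define D where "D = (\<chi> i j. if i = j then d i else 0)"
  have const_sum: "(\<Sum>i\<in>I. [:f i:]) = [:\<Sum>i\<in>I. f i:]" for I and f :: "'a \<Rightarrow> complex"
    by (induction I rule: infinite_finite_induct) auto
  have lift_mult: "lift (M ** N) = lift M ** lift N" for M N
    by (simp add: lift_def matrix_matrix_mult_def vec_eq_iff const_sum mult.commute)
  have "lift P ** lift Q = mat 1"
    unfolding lift_mult[symmetric] PQ by (simp add: lift_def mat_def vec_eq_iff one_pCons)
  then have "det (lift P) * det (lift Q) = 1"
    by (metis det_I det_mul)
  then have nz: "det (lift P) \<noteq> 0"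
    by auto
  have "(mat [:0, 1:] - lift A) ** lift P = lift P ** (mat [:0, 1:] - lift D)"
  proof -
    have "mat [:0, 1:] ** lift P = lift P ** mat [:0, 1:]"
      by (simp add: mat_def matrix_matrix_mult_def vec_eq_iff if_distrib [of "\<lambda>x. x * _"]
          if_distrib [of "\<lambda>x. _ * x"] mult.commute cong: if_cong)
    moreover have "(M - N) ** K = M ** K - N ** K" "K ** (M - N) = K ** M - K ** N"
      for M N K :: "complex poly ^ 'a ^ 'a"
      by (simp_all add: matrix_matrix_mult_def vec_eq_iff algebra_simps sum_subtractf)
    ultimately show ?thesis
      using AP by (simp add: D_def flip: lift_mult)
  qed
  then have "det (mat [:0, 1:] - lift A) = det (mat [:0, 1:] - lift D)"
    using nz by (metis det_mul mult.commute mult_right_cancel)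
  also have "\<dots> = (\<Prod>i\<in>UNIV. (mat [:0, 1:] - lift D) $ i $ i)"
    by (rule det_diagonal) (simp add: lift_def D_def mat_def)
  also have "\<dots> = (\<Prod>i\<in>UNIV. [:- d i, 1:])"
    by (simp add: lift_def D_def mat_def)
  finally show ?thesis
    by (simp add: charpoly_def lift_def)
qed

lemma schmidt_coeffs_diagonalized:
  assumes "diagonalized_by (reduced_density \<psi>) d"
  shows "schmidt_coeffs \<psi> = image_mset (\<lambda>i. Re (d i)) (mset_set UNIV)"
  using charpoly_diagonalized[OF assms]
  by (simp add: schmidt_coeffs_def proots_prod_linear multiset.map_comp comp_def)

text \<open>The Kronecker product, indexed by pairs to match the index types of
  \<open>tensor_state\<close>.\<close>

definition kron :: "complex ^ 'n ^ 'm \<Rightarrow> complex ^ 'q ^ 'p \<Rightarrow> complex ^ ('n \<times> 'q) ^ ('m \<times> 'p)" where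
  "kron A B = (\<chi> r s. A $ fst r $ fst s * B $ snd r $ snd s)"

lemma kron_mult: "kron A B ** kron C D = kron (A ** C) (B ** D)"
  by (simp add: kron_def matrix_matrix_mult_def vec_eq_iff sum_product sum.cartesian_product
      mult_ac case_prod_unfold flip: UNIV_Times_UNIV)

lemma reduced_density_tensor:
  "reduced_density (\<psi> \<otimes>\<^sub>s \<phi>) = kron (reduced_density \<psi>) (reduced_density \<phi>)"
  by (simp add: kron_def reduced_density_def tensor_state_def vec_eq_iff sum_product
      sum.cartesian_product mult_ac case_prod_unfold flip: UNIV_Times_UNIV)

text \<open>By the mixed-product rule \<open>kron_mult\<close>, the Kronecker product of the two
  eigenvector matrices works, as that of two diagonal matrices is again diagonal.\<close>

lemma diagonalized_by_kron:
  assumes "diagonalized_by A d" "diagonalized_by B e"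
  shows "diagonalized_by (kron A B) (\<lambda>(i, k). d i * e k)"
proof -
  obtain P Q where P: "P ** Q = mat 1" "A ** P = P ** (\<chi> i j. if i = j then d i else 0)"
    using assms(1) by (auto simp: diagonalized_by_def)
  obtain R S where R: "R ** S = mat 1" "B ** R = R ** (\<chi> i j. if i = j then e i else 0)"
    using assms(2) by (auto simp: diagonalized_by_def)
  have "kron P R ** kron Q S = mat 1"
    unfolding kron_mult P R by (auto simp: kron_def mat_def vec_eq_iff)
  moreover have "kron A B ** kron P R
      = kron P R ** (\<chi> r s. if r = s then (case r of (i, k) \<Rightarrow> d i * e k) else 0)"
  proof -
    have "(\<chi> r s. if r = s then (case r of (i, k) \<Rightarrow> d i * e k) else 0)
        = kron (\<chi> i j. if i = j then d i else 0) (\<chi> i j. if i = j then e i else 0)"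
      by (auto simp: kron_def vec_eq_iff)
    then show ?thesis
      by (simp only: kron_mult P R)
  qed
  ultimately show ?thesis
    unfolding diagonalized_by_def by blast
qed

section \<open>Two-qubit states\<close>

lemma UNIV_2_times_2: "(UNIV :: (2 \<times> 2) set) = {(1, 1), (1, 2), (2, 1), (2, 2)}"
  by (auto simp: UNIV_2 simp flip: UNIV_Times_UNIV)

text \<open>The inequality says that half the Bloch vector has length at most 1/2. It is
  nonnegativity of the determinant \<open>a * (1 - a) - (cmod b)\<^sup>2\<close>, the squared
  modulus of the determinant of the amplitudes, after completing the square.\<close>

lemma two_qubit_reduced_density:
  fixes \<psi> :: two_qubit
  assumes "pure_state \<psi>"
  obtains a :: real and b :: complex where
    "reduced_density \<psi> $ 1 $ 1 = of_real a" "reduced_density \<psi> $ 2 $ 2 = of_real (1 - a)"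
    "reduced_density \<psi> $ 1 $ 2 = b" "reduced_density \<psi> $ 2 $ 1 = cnj b"
    "(a - 1/2)\<^sup>2 + (cmod b)\<^sup>2 \<le> (1/2)\<^sup>2"
proof
  define x y z w where "x = \<psi> $ (1, 1)" and "y = \<psi> $ (1, 2)"
    and "z = \<psi> $ (2, 1)" and "w = \<psi> $ (2, 2)"
  note xyzw = this
  have "(\<Sum>i\<in>UNIV. (cmod (\<psi> $ i))\<^sup>2) = 1"
    using assms by (simp add: pure_state_def norm_vec_def L2_set_def)
  then have norm: "(cmod x)\<^sup>2 + (cmod y)\<^sup>2 + ((cmod z)\<^sup>2 + (cmod w)\<^sup>2) = 1"
    unfolding UNIV_2_times_2 by (simp add: xyzw)
  define a where "a = (cmod x)\<^sup>2 + (cmod y)\<^sup>2"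
  define b where "b = x * cnj z + y * cnj w"
  show "reduced_density \<psi> $ 1 $ 1 = of_real a"
    by (simp add: reduced_density_def sum_2 a_def complex_norm_square xyzw del: of_real_power)
  have "1 - a = (cmod z)\<^sup>2 + (cmod w)\<^sup>2"
    using norm by (simp add: a_def)
  then show "reduced_density \<psi> $ 2 $ 2 = of_real (1 - a)"
    by (simp add: reduced_density_def sum_2 complex_norm_square xyzw
        del: of_real_diff of_real_power)
  show "reduced_density \<psi> $ 1 $ 2 = b" "reduced_density \<psi> $ 2 $ 1 = cnj b"
    by (simp_all add: reduced_density_def sum_2 b_def mult.commute xyzw)
  \<comment> \<open>Lagrange's identity\<close>
  have "(cmod b)\<^sup>2 + (cmod (x * w - y * z))\<^sup>2 = a * ((cmod z)\<^sup>2 + (cmod w)\<^sup>2)"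
    unfolding a_def b_def cmod_power2 by simp algebra
  then have "(cmod b)\<^sup>2 \<le> a * (1 - a)"
    unfolding \<open>1 - a = _\<close> using zero_le_power2[of "cmod (x * w - y * z)"] by linarith
  then show "(a - 1/2)\<^sup>2 + (cmod b)\<^sup>2 \<le> (1/2)\<^sup>2"
    by (simp add: power2_eq_square algebra_simps)
qed

text \<open>The eigenvalues are \<open>1/2 + r\<close> and \<open>1/2 - r\<close>, where
  \<open>r\<close> is half the length of the Bloch vector; \<open>p\<close> is the larger one.
  Eigenvectors are given explicitly.\<close>

lemma two_qubit_diagonalized:
  fixes \<psi> :: two_qubit
  assumes "pure_state \<psi>"
  obtains p :: real where "1/2 \<le> p" "p \<le> 1"
    "diagonalized_by (reduced_density \<psi>) (\<lambda>i. of_real (if i = 1 then p else 1 - p))"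
proof -
  obtain a :: real and b :: complex where
    \<rho>: "reduced_density \<psi> $ 1 $ 1 = of_real a" "reduced_density \<psi> $ 2 $ 2 = of_real (1 - a)"
      "reduced_density \<psi> $ 1 $ 2 = b" "reduced_density \<psi> $ 2 $ 1 = cnj b"
    and le: "(a - 1/2)\<^sup>2 + (cmod b)\<^sup>2 \<le> (1/2)\<^sup>2"
    using two_qubit_reduced_density[OF assms] by metis
  define r where "r = sqrt ((a - 1/2)\<^sup>2 + (cmod b)\<^sup>2)"
  define p where "p = 1/2 + r"
  have r: "0 \<le> r" "r\<^sup>2 = (a - 1/2)\<^sup>2 + (cmod b)\<^sup>2"
    by (simp_all add: r_def)
  have "r \<le> 1/2"
    using le unfolding r_def by (intro real_le_lsqrt) auto
  have "\<exists>P :: complex ^ 2 ^ 2. det P \<noteq> 0 \<and> reduced_density \<psi> ** P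
      = P ** (\<chi> i j. if i = j then of_real (if i = 1 then p else 1 - p) else 0)"
  \<comment> \<open>For \<open>b = 0\<close> the matrix is already diagonal, and at most the two
    basis vectors have to be swapped to put the larger eigenvalue first.\<close>
  proof (cases "b = 0")
    case True
    then have "p = a \<or> p = 1 - a"
      by (auto simp: p_def r_def abs_if)
    then show ?thesis
    proof
      assume "p = a"
      then show ?thesis
        using True \<rho> by (intro exI[of _ "mat 1"])
          (simp add: vec_eq_iff forall_2)
    next
      assume "p = 1 - a"
      then show ?thesis
        using True \<rho> by (intro exI[of _ "\<chi> i j. if i = j then 0 else 1"])
          (simp add: vec_eq_iff forall_2 matrix_matrix_mult_def sum_2 det_2)
    qed
  next
    case False
    \<comment> \<open>The column for an eigenvalue t is (b, t - a): it solves the first row of the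
      eigenvector equation identically, and the second row becomes the characteristic
      equation.\<close>
    define P :: "complex ^ 2 ^ 2" where
      "P = (\<chi> i j. if i = 1 then b else of_real (if j = 1 then p - a else 1 - p - a))"
    have "r \<noteq> 0"
      using False by (simp add: r_def add_nonneg_eq_0_iff)
    have "det P = - 2 * of_real r * b"
      by (simp add: det_2 P_def p_def algebra_simps)
    with False \<open>r \<noteq> 0\<close> have "det P \<noteq> 0"
      by simp
    have "cnj b * b = of_real ((cmod b)\<^sup>2)"
      by (simp add: complex_norm_square mult.commute del: of_real_power)
    \<comment> \<open>The characteristic equation at \<open>p\<close>; it is symmetric under
      exchanging \<open>p\<close> and \<open>1 - p\<close>, so it serves both columns.\<close>
    moreover have "(cmod b)\<^sup>2 = (p - a) * (p - (1 - a))"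
      using r(2) by (simp add: p_def power2_eq_square field_simps)
    ultimately have b: "cnj b * b = (of_real p - of_real a) * (of_real p - (1 - of_real a))"
      by simp
    have "of_real a * b + b * (of_real p - of_real a) = b * of_real p"
      "of_real a * b + b * (1 - of_real p - of_real a) = b * (1 - of_real p)"
      by (simp_all add: algebra_simps)
    moreover have "cnj b * b + (1 - of_real a) * (of_real p - of_real a)
        = (of_real p - of_real a) * of_real p"
      "cnj b * b + (1 - of_real a) * (1 - of_real p - of_real a)
        = (1 - of_real p - of_real a) * (1 - of_real p)"
      unfolding b by (simp_all add: algebra_simps)
    ultimately have "reduced_density \<psi> ** P
        = P ** (\<chi> i j. if i = j then of_real (if i = 1 then p else 1 - p) else 0)"
      using \<rho> by (simp add: vec_eq_iff forall_2 matrix_matrix_mult_def sum_2 P_def)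
    with \<open>det P \<noteq> 0\<close> show ?thesis
      by blast
  qed
  then have "diagonalized_by (reduced_density \<psi>) (\<lambda>i. of_real (if i = 1 then p else 1 - p))"
    unfolding diagonalized_by_def invertible_det_nz[symmetric] invertible_def by blast
  with r(1) \<open>r \<le> 1/2\<close> show ?thesis
    by (intro that[of p]) (simp_all add: p_def)
qed

section \<open>Spectra and entropies of products of two-qubit states\<close>

lemma two_qubit_schmidt_coeffs:
  fixes \<psi> :: two_qubit
  assumes "diagonalized_by (reduced_density \<psi>) (\<lambda>i. of_real (if i = 1 then p else 1 - p))"
  shows "schmidt_coeffs \<psi> = {#p, 1 - p#}"
  by (simp add: schmidt_coeffs_diagonalized[OF assms] UNIV_2)

lemma tensor_schmidt_coeffs:
  fixes \<psi> \<phi> :: two_qubit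
  assumes "diagonalized_by (reduced_density \<psi>) (\<lambda>i. of_real (if i = 1 then p else 1 - p))"
    and "diagonalized_by (reduced_density \<phi>) (\<lambda>i. of_real (if i = 1 then q else 1 - q))"
  shows "schmidt_coeffs (\<psi> \<otimes>\<^sub>s \<phi>) = {#p * q, p * (1 - q), (1 - p) * q, (1 - p) * (1 - q)#}"
  using schmidt_coeffs_diagonalized[OF diagonalized_by_kron[OF assms, folded reduced_density_tensor]]
  unfolding UNIV_2_times_2 by simp

lemma entropy_additive:
  fixes p q r s :: real
  assumes "0 \<le> p" "0 \<le> q" "0 \<le> r" "0 \<le> s" "p + q = 1" "r + s = 1"
  shows "p * r * log 2 (p * r) + p * s * log 2 (p * s)
        + (q * r * log 2 (q * r) + q * s * log 2 (q * s))
      = (p * log 2 p + q * log 2 q) + (r * log 2 r + s * log 2 s)"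
proof -
  \<comment> \<open>If \<open>x\<close> or \<open>y\<close> is 0, every term has a zero factor, so
    the rule survives there.\<close>
  have mult: "x * y * log 2 (x * y) = y * (x * log 2 x) + x * (y * log 2 y)"
    if "0 \<le> x" "0 \<le> y" for x y :: real
    using that by (cases "x = 0 \<or> y = 0") (auto simp: log_mult algebra_simps)
  have "p * r * log 2 (p * r) + p * s * log 2 (p * s)
        + (q * r * log 2 (q * r) + q * s * log 2 (q * s))
      = (r + s) * (p * log 2 p + q * log 2 q) + (p + q) * (r * log 2 r + s * log 2 s)"
    unfolding mult[OF assms(1,3)] mult[OF assms(1,4)] mult[OF assms(2,3)] mult[OF assms(2,4)]
    by (simp add: algebra_simps)
  with assms show ?thesis
    by simp
qed

lemma tensor_entanglement:
  fixes \<psi> \<phi> :: two_qubit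
  assumes "diagonalized_by (reduced_density \<psi>) (\<lambda>i. of_real (if i = 1 then p else 1 - p))"
    and "diagonalized_by (reduced_density \<phi>) (\<lambda>i. of_real (if i = 1 then q else 1 - q))"
    and "0 \<le> p" "p \<le> 1" "0 \<le> q" "q \<le> 1"
  shows "entanglement (\<psi> \<otimes>\<^sub>s \<phi>) = entanglement \<psi> + entanglement \<phi>"
  unfolding entanglement_def tensor_schmidt_coeffs[OF assms(1,2)]
    two_qubit_schmidt_coeffs[OF assms(1)] two_qubit_schmidt_coeffs[OF assms(2)]
  using entropy_additive[of p "1 - p" q "1 - q"] assms by simp

lemma product_spectrum_eq_imp:
  fixes p q p' q' :: real
  assumes bounds: "1/2 \<le> p" "p \<le> 1" "1/2 \<le> q" "q \<le> 1"
      "1/2 \<le> p'" "p' \<le> 1" "1/2 \<le> q'" "q' \<le> 1"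
    and eq: "{#p * q, p * (1 - q), (1 - p) * q, (1 - p) * (1 - q)#}
      = {#p' * q', p' * (1 - q'), (1 - p') * q', (1 - p') * (1 - q')#}"
  shows "p' = p \<or> p' = q"
proof -
  define M where "M p q = {#p * q, p * (1 - q), (1 - p) * q, (1 - p) * (1 - q)#}" for p q :: real
  \<comment> \<open>The parameters are at least 1/2, so replacing a factor by its complement cannot
    increase a product.\<close>
  have extremal: "(1 - p) * (1 - q) \<le> x \<and> x \<le> p * q"
    if "1/2 \<le> p" "p \<le> 1" "1/2 \<le> q" "q \<le> 1" "x \<in># M p q" for p q x :: real
    using that unfolding M_def by (auto intro!: mult_mono)
  have "M p q = M p' q'"
    using eq by (simp only: M_def)
  moreover have "p * q \<in># M p q" "p' * q' \<in># M p' q'"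
    "(1 - p) * (1 - q) \<in># M p q" "(1 - p') * (1 - q') \<in># M p' q'"
    by (simp_all add: M_def)
  ultimately have "p * q = p' * q'" "(1 - p) * (1 - q) = (1 - p') * (1 - q')"
    using extremal bounds by (metis antisym)+
  \<comment> \<open>Equal products and equal complementary products give
    \<open>p + q = p' + q'\<close>, so by Vieta \<open>p'\<close> is a root of the quadratic with
    roots \<open>p\<close> and \<open>q\<close>.\<close>
  then have "(p' - p) * (p' - q) = 0"
    by algebra
  then show ?thesis
    by auto
qed

section \<open>Transfer of entanglement from donor to acceptor\<close>

theorem mainTheorem1:
  fixes \<psi> \<phi> :: two_qubit and \<Delta>E :: real
  assumes "pure_state \<psi>" and "pure_state \<phi>"
    and "\<Delta>E > 0"
    and "\<Delta>E \<le> entanglement \<psi>"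
    and "entanglement \<phi> + \<Delta>E \<le> 1"
  shows "(\<exists>\<psi>' \<phi>' :: two_qubit.
            pure_state \<psi>' \<and> pure_state \<phi>' \<and>
            entanglement \<psi>' = entanglement \<psi> - \<Delta>E \<and>
            entanglement \<phi>' = entanglement \<phi> + \<Delta>E \<and>
            LOCC_transformable (\<psi> \<otimes>\<^sub>s \<phi>) (\<psi>' \<otimes>\<^sub>s \<phi>'))
         \<longleftrightarrow> \<Delta>E = entanglement \<psi> - entanglement \<phi>"
proof -
  obtain p where p: "1/2 \<le> p" "p \<le> 1"
    "diagonalized_by (reduced_density \<psi>) (\<lambda>i. of_real (if i = 1 then p else 1 - p))"
    using two_qubit_diagonalized[OF assms(1)] by blast
  obtain q where q: "1/2 \<le> q" "q \<le> 1"
    "diagonalized_by (reduced_density \<phi>) (\<lambda>i. of_real (if i = 1 then q else 1 - q))"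
    using two_qubit_diagonalized[OF assms(2)] by blast
  note spectrum = tensor_schmidt_coeffs[OF p(3) q(3)]
  show ?thesis
  proof
    assume "\<exists>\<psi>' \<phi>' :: two_qubit.
            pure_state \<psi>' \<and> pure_state \<phi>' \<and>
            entanglement \<psi>' = entanglement \<psi> - \<Delta>E \<and>
            entanglement \<phi>' = entanglement \<phi> + \<Delta>E \<and>
            LOCC_transformable (\<psi> \<otimes>\<^sub>s \<phi>) (\<psi>' \<otimes>\<^sub>s \<phi>')"
    then obtain \<psi>' \<phi>' :: two_qubit where pure: "pure_state \<psi>'" "pure_state \<phi>'"
      and E: "entanglement \<psi>' = entanglement \<psi> - \<Delta>E" "entanglement \<phi>' = entanglement \<phi> + \<Delta>E"
      and locc: "LOCC_transformable (\<psi> \<otimes>\<^sub>s \<phi>) (\<psi>' \<otimes>\<^sub>s \<phi>')"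
      by blast
    obtain p' where p': "1/2 \<le> p'" "p' \<le> 1"
      "diagonalized_by (reduced_density \<psi>') (\<lambda>i. of_real (if i = 1 then p' else 1 - p'))"
      using two_qubit_diagonalized[OF pure(1)] by blast
    obtain q' where q': "1/2 \<le> q'" "q' \<le> 1"
      "diagonalized_by (reduced_density \<phi>') (\<lambda>i. of_real (if i = 1 then q' else 1 - q'))"
      using two_qubit_diagonalized[OF pure(2)] by blast
    note spectrum' = tensor_schmidt_coeffs[OF p'(3) q'(3)]
    have "schmidt_coeffs (\<psi> \<otimes>\<^sub>s \<phi>) = schmidt_coeffs (\<psi>' \<otimes>\<^sub>s \<phi>')"
    proof (rule LOCC_transformable_entanglement_eq_imp_schmidt_coeffs_eq[OF locc])
      \<comment> \<open>By additivity the loss of the donor and the gain of the acceptor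
        cancel.\<close>
      show "entanglement (\<psi> \<otimes>\<^sub>s \<phi>) = entanglement (\<psi>' \<otimes>\<^sub>s \<phi>')"
        using tensor_entanglement[OF p(3) q(3)] tensor_entanglement[OF p'(3) q'(3)]
          E p q p' q' by simp
      show "sum_mset (schmidt_coeffs (\<psi> \<otimes>\<^sub>s \<phi>)) = sum_mset (schmidt_coeffs (\<psi>' \<otimes>\<^sub>s \<phi>'))"
        by (simp add: spectrum spectrum' algebra_simps)
    qed (use p q p' q' in \<open>auto simp: spectrum spectrum'\<close>)
    then have "p' = p \<or> p' = q"
      using p q p' q' by (intro product_spectrum_eq_imp) (simp_all only: spectrum spectrum')
    moreover have "p' \<noteq> p"
    proof
      assume "p' = p"
      then have "entanglement \<psi>' = entanglement \<psi>"
        by (simp only: entanglement_def two_qubit_schmidt_coeffs[OF p(3)]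
            two_qubit_schmidt_coeffs[OF p'(3)])
      with E assms(3) show False by simp
    qed
    ultimately have "entanglement \<psi>' = entanglement \<phi>"
      by (simp only: entanglement_def two_qubit_schmidt_coeffs[OF q(3)]
          two_qubit_schmidt_coeffs[OF p'(3)] simp_thms)
    with E show "\<Delta>E = entanglement \<psi> - entanglement \<phi>"
      by simp
  next
    assume \<Delta>E: "\<Delta>E = entanglement \<psi> - entanglement \<phi>"
    \<comment> \<open>Swapping the factors only permutes the four products, so Nielsen's criterion
      holds with equality throughout.\<close>
    have "schmidt_coeffs (\<psi> \<otimes>\<^sub>s \<phi>) = schmidt_coeffs (\<phi> \<otimes>\<^sub>s \<psi>)"
      unfolding spectrum tensor_schmidt_coeffs[OF q(3) p(3)]
      by (simp add: mult.commute add_mset_commute)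
    then have "LOCC_transformable (\<psi> \<otimes>\<^sub>s \<phi>) (\<phi> \<otimes>\<^sub>s \<psi>)"
      by (simp add: LOCC_transformable_def schmidt_list_def)
    with \<Delta>E assms(1,2) show "\<exists>\<psi>' \<phi>' :: two_qubit.
            pure_state \<psi>' \<and> pure_state \<phi>' \<and>
            entanglement \<psi>' = entanglement \<psi> - \<Delta>E \<and>
            entanglement \<phi>' = entanglement \<phi> + \<Delta>E \<and>
            LOCC_transformable (\<psi> \<otimes>\<^sub>s \<phi>) (\<psi>' \<otimes>\<^sub>s \<phi>')"
      by (intro exI[of _ \<phi>] exI[of _ \<psi>]) simp
  qed
qed

end
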